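(* Let $D\subsetneq\mathbb{R}^n$ be an open set with $\partial D\neq\emptyset$. For any $x\in D$ and $r\in(0,1)$, $$B_j(x,R_1)\subset B_{\tilde c}(x,r)\subset B_j(x,R_2),$$ where $R_1=\log(1+r)$ and $R_2=\log\left(1+\frac{r}{1-r}\right)$. Moreover, $R_2/R_1\to 1$ as $r\to 0$.
   Context: $d(x)=d(x,\partial D)$ is the Euclidean distance from $x$ to the boundary $\partial D$ of $D$ in $\mathbb{R}^n$. For $x,y\in D$: $\tilde c_D(x,y)=\sup_{p\in\partial D}\frac{|x-y|}{\max\{|x-p|,|y-p|\}}$, and the distance ratio metric is $j_D(x,y)=\log\left(1+\frac{|x-y|}{\min\{d(x),d(y)\}}\right)$. Metric balls: $B_{\tilde c}(x,r)=\{y\in D:\tilde c_D(x,y)<r\}$ and $B_j(x,R)=\{y\in D: j_D(x,y)<R\}$. *)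

theory Defs
  imports "HOL-Analysis.Analysis"
begin

definition bdist :: "(real ^ 'n) set \<Rightarrow> real ^ 'n \<Rightarrow> real" where
  "bdist D x = infdist x (frontier D)"

text \<open>For an open set \<open>D\<close> with nonempty boundary and \<open>x, y \<in> D\<close>, no denominator below vanishes, and
  the quotients are bounded above by 2, so the supremum is a genuine real number.\<close>

definition ctilde :: "(real ^ 'n) set \<Rightarrow> real ^ 'n \<Rightarrow> real ^ 'n \<Rightarrow> real" where
  "ctilde D x y = (SUP p\<in>frontier D. dist x y / max (dist x p) (dist y p))"

definition jmetric :: "(real ^ 'n) set \<Rightarrow> real ^ 'n \<Rightarrow> real ^ 'n \<Rightarrow> real" where
  "jmetric D x y = ln (1 + dist x y / min (bdist D x) (bdist D y))"

definition ball_ctilde :: "(real ^ 'n) set \<Rightarrow> real ^ 'n \<Rightarrow> real \<Rightarrow> (real ^ 'n) set" where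
  "ball_ctilde D x r = {y \<in> D. ctilde D x y < r}"

definition ball_j :: "(real ^ 'n) set \<Rightarrow> real ^ 'n \<Rightarrow> real \<Rightarrow> (real ^ 'n) set" where
  "ball_j D x R = {y \<in> D. jmetric D x y < R}"

definition R1 :: "real \<Rightarrow> real" where
  "R1 r = ln (1 + r)"

definition R2 :: "real \<Rightarrow> real" where
  "R2 r = ln (1 + r / (1 - r))"

end

theory Submission
  imports Defs "HOL-Real_Asymp.Real_Asymp"
begin

text \<open>With \<open>m = min (d x) (d y)\<close> and \<open>t = \<bar>x - y\<bar>\<close>, every boundary point \<open>p\<close> has
  \<open>max \<bar>x - p\<bar> \<bar>y - p\<bar> \<ge> m\<close>, and a boundary point nearest to \<open>{x, y}\<close> has
  \<open>max \<bar>x - p\<bar> \<bar>y - p\<bar> \<le> m + t\<close>. Hence \<open>t / (m + t) \<le> c(x, y) \<le> t / m\<close>.\<close>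

lemma bdist_pos:
  assumes "open D" "frontier D \<noteq> {}" "x \<in> D"
  shows "bdist D x > 0"
proof -
  have "x \<notin> frontier D"
    using assms by (simp add: frontier_def interior_open)
  \<comment> \<open>\<open>infdist\<close> to the empty set is 0 by convention, so a point off the
    closed frontier has positive distance only because the frontier is nonempty.\<close>
  then show ?thesis
    using assms(2) infdist_pos_not_in_closed[of "frontier D" x] by (simp add: bdist_def)
qed

lemma min_bdist_pos:
  assumes "open D" "frontier D \<noteq> {}" "x \<in> D" "y \<in> D"
  shows "min (bdist D x) (bdist D y) > 0"
  using bdist_pos[OF assms(1,2)] assms(3,4) by simp

lemma min_bdist_le_max_dist:
  assumes "p \<in> frontier D"
  shows "min (bdist D x) (bdist D y) \<le> max (dist x p) (dist y p)"
  using infdist_le[OF assms, of x] by (auto simp: bdist_def)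

text \<open>The bound does not depend on \<open>p\<close>, so it serves twice: it bounds the
  supremum, and it shows that the family of quotients is bounded above.\<close>

lemma ctilde_quotient_le:
  assumes "open D" "x \<in> D" "y \<in> D" "p \<in> frontier D"
  shows "dist x y / max (dist x p) (dist y p) \<le> dist x y / min (bdist D x) (bdist D y)"
proof -
  have "frontier D \<noteq> {}" using assms(4) by auto
  then have "min (bdist D x) (bdist D y) > 0"
    using min_bdist_pos[OF assms(1) _ assms(2,3)] by simp
  then show ?thesis
    using min_bdist_le_max_dist[OF assms(4), of x y] by (intro divide_left_mono) auto
qed

lemma ctilde_le:
  assumes "open D" "frontier D \<noteq> {}" "x \<in> D" "y \<in> D"
  shows "ctilde D x y \<le> dist x y / min (bdist D x) (bdist D y)"
  unfolding ctilde_def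
  using assms ctilde_quotient_le by (intro cSUP_least) auto

lemma ctilde_ge:
  assumes "open D" "frontier D \<noteq> {}" "x \<in> D" "y \<in> D"
  shows "dist x y / (min (bdist D x) (bdist D y) + dist x y) \<le> ctilde D x y"
proof -
  define m where "m = min (bdist D x) (bdist D y)"
  have m: "m > 0"
    using min_bdist_pos[OF assms] by (simp add: m_def)
  \<comment> \<open>\<open>z\<close> is whichever of \<open>x\<close>, \<open>y\<close> lies nearer
    to the frontier, and \<open>p\<close> below is a frontier point nearest to \<open>z\<close>. The
    other point reaches \<open>p\<close> by a detour through \<open>z\<close>.\<close>
  obtain z where z: "z \<in> {x, y}" "m = infdist z (frontier D)"
    unfolding m_def bdist_def min_def by (metis insertI1 insertI2)
  obtain p where p: "p \<in> frontier D" "infdist z (frontier D) = dist z p"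
    using infdist_attains_inf[OF frontier_closed assms(2)] by blast
  have le: "max (dist x p) (dist y p) \<le> m + dist x y"
    using z p dist_triangle[of x p y] dist_triangle[of y p x] by (auto simp: dist_commute)
  have "max (dist x p) (dist y p) > 0"
    using m min_bdist_le_max_dist[OF p(1), of x y] unfolding m_def by linarith
  then have "dist x y / (m + dist x y) \<le> dist x y / max (dist x p) (dist y p)"
    using le by (intro divide_left_mono) auto
  also have "\<dots> \<le> ctilde D x y"
    unfolding ctilde_def
    \<comment> \<open>A real supremum dominates its members only if the family is bounded
      above.\<close>
    by (rule cSUP_upper[OF p(1)], rule bdd_aboveI2, erule ctilde_quotient_le[OF assms(1,3,4)])
  finally show ?thesis
    by (simp add: m_def)
qed

lemma ball_j_subset_ball_ctilde:
  assumes "open D" "frontier D \<noteq> {}" "x \<in> D" "0 < r"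
  shows "ball_j D x (R1 r) \<subseteq> ball_ctilde D x r"
proof
  fix y assume "y \<in> ball_j D x (R1 r)"
  then have y: "y \<in> D" and less: "jmetric D x y < R1 r"
    by (auto simp: ball_j_def)
  have "min (bdist D x) (bdist D y) > 0"
    using min_bdist_pos[OF assms(1-3) y] .
  then have "dist x y / min (bdist D x) (bdist D y) \<ge> 0"
    by simp
  \<comment> \<open>\<open>R1\<close> makes the hypothesis exactly
    \<open>ln (1 + t / m) < ln (1 + r)\<close>; nonnegativity of \<open>t / m\<close> keeps both
    arguments positive, so \<open>ln\<close> cancels.\<close>
  then have "dist x y / min (bdist D x) (bdist D y) < r"
    using less \<open>0 < r\<close> unfolding jmetric_def R1_def by (subst (asm) ln_less_cancel_iff) auto
  then show "y \<in> ball_ctilde D x r"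
    using y ctilde_le[OF assms(1-3) y] by (simp add: ball_ctilde_def)
qed

lemma ball_ctilde_subset_ball_j:
  assumes "open D" "frontier D \<noteq> {}" "x \<in> D" "0 < r" "r < 1"
  shows "ball_ctilde D x r \<subseteq> ball_j D x (R2 r)"
proof
  fix y assume "y \<in> ball_ctilde D x r"
  then have y: "y \<in> D" and less: "ctilde D x y < r"
    by (auto simp: ball_ctilde_def)
  define m where "m = min (bdist D x) (bdist D y)"
  have m: "m > 0"
    using min_bdist_pos[OF assms(1-3) y] by (simp add: m_def)
  have "dist x y / (m + dist x y) < r"
    using ctilde_ge[OF assms(1-3) y] less by (simp add: m_def)
  moreover have "m + dist x y > 0"
    using m zero_le_dist[of x y] by linarith
  ultimately have "dist x y < r * (m + dist x y)"
    by (simp add: pos_divide_less_eq)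
  \<comment> \<open>Collecting \<open>t = dist x y\<close> gives \<open>(1 - r) * t < r * m\<close>;
    dividing by \<open>m * (1 - r) > 0\<close> produces the quotient inside
    \<open>R2\<close>.\<close>
  then have "dist x y / m < r / (1 - r)"
    using m \<open>r < 1\<close> by (simp add: field_simps)
  moreover have "dist x y / m \<ge> 0"
    using m by simp
  ultimately have "ln (1 + dist x y / m) < ln (1 + r / (1 - r))"
    by (subst ln_less_cancel_iff) auto
  then show "y \<in> ball_j D x (R2 r)"
    using y by (simp add: ball_j_def jmetric_def R2_def m_def)
qed

text \<open>Near 0, \<open>R2 r = - ln (1 - r)\<close> and \<open>R1 r = ln (1 + r)\<close> are both
  asymptotic to \<open>r\<close>.\<close>

lemma R2_div_R1_tendsto: "((\<lambda>r. R2 r / R1 r) \<longlongrightarrow> 1) (at_right 0)"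
  unfolding R1_def R2_def by real_asymp

theorem theorem4:
  fixes D :: "(real ^ 'n) set"
  assumes "open D" and "D \<noteq> UNIV" and "frontier D \<noteq> {}"
  shows "(\<forall>x\<in>D. \<forall>r\<in>{0<..<1}.
            ball_j D x (R1 r) \<subseteq> ball_ctilde D x r \<and>
            ball_ctilde D x r \<subseteq> ball_j D x (R2 r)) \<and>
         ((\<lambda>r. R2 r / R1 r) \<longlongrightarrow> 1) (at_right 0)"
  using ball_j_subset_ball_ctilde[OF assms(1,3)] ball_ctilde_subset_ball_j[OF assms(1,3)]
    R2_div_R1_tendsto by simp

end
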